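(* Consider the system $x_{k+1}=A(p_k)x_k$, $k\in\mathbb{N}$, and assume it is polytopic with functions $\xi_i$ and matrices $A_i\in\mathbb{R}^{n_x\times n_x}$, $i\in\mathcal{N}$. Consider the statements: (L1.1) There exist matrices $\bar{P}_i\in\mathbb{S}^{n_x}$, $i\in\mathcal{N}$, such that the system is poly-QS with $V(\pi,x)=x^\top P(\pi)x$, $P(\pi)=\sum_{i\in\mathcal{N}}\xi_i(\pi)\bar{P}_i$, being a poly-QLF. (L1.2) There exist matrices $\bar{P}_i\in\mathbb{S}^{n_x}$, $\bar{S}_i=\bar{P}_i^{-1}$ and $X_i\in\mathbb{R}^{n_x\times n_x}$, $i\in\mathcal{N}$, such that $$\begin{bmatrix} X_i+X_i^\top-\bar{S}_i & \star\\ A_iX_i & \bar{S}_j\end{bmatrix}\succ 0\quad\text{for all } i,j\in\mathcal{N}.$$ (L1.3) There exist matrices $\bar{P}_i\in\mathbb{S}^{n_x}$ and $X_i\in\mathbb{R}^{n_x\times n_x}$, $i\in\mathcal{N}$, such that $$\begin{bmatrix} X_i+X_i^\top-\bar{P}_j & \star\\ A_i^\top X_i^\top & \bar{P}_i\end{bmatrix}\succ 0\quad\text{for all } i,j\in\mathcal{N}.$$ (L1.4) There exist matrices $\bar{P}_i\in\mathbb{S}^{n_x}$ and $\bar{S}_i=\bar{P}_i^{-1}$, $i\in\mathcal{N}$, such that $$\begin{bmatrix} \bar{S}_i & \star\\ A_i\bar{S}_i & \bar{S}_j\end{bmatrix}\succ 0\quad\text{for all } i,j\in\mathcal{N}.$$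 Then (L1.4) $\Leftrightarrow$ (L1.2) $\Rightarrow$ (L1.1) and (L1.3) $\Rightarrow$ (L1.1), where the implications hold with the same matrices $\bar{P}_i$, $i\in\mathcal{N}$. Any matrices $X_i$, $i\in\mathcal{N}$, satisfying the matrix inequalities in (L1.2) or in (L1.3) are non-singular. If, in addition, the system is strictly polytopic, then all four statements are equivalent.
   Context: Notation: $\mathbb{N}=\{0,1,2,\dots\}$; $\mathbb{S}^n$ is the set of symmetric $n\times n$ real matrices; $M\succ 0$ means $M$ is symmetric positive definite; $\star$ denotes the block completing a symmetric matrix. Setting: $\mathbb{P}\subseteq\mathbb{R}^{n_p}$ is a known compact set, $A\colon\mathbb{P}\to\mathbb{R}^{n_x\times n_x}$, and the unknown parameter satisfies $p_k\in\mathbb{P}$ for all $k\in\mathbb{N}$ (arbitrary sequences in $\mathbb{P}$ are admissible). Let $\mathcal{N}=\{1,\dots,N\}$. Polytopic: the system is polytopic if there exist continuous functions $\xi_i\colon\mathbb{P}\to\mathbb{R}_{\geqslant 0}$, $i\in\mathcal{N}$, with $\sum_{i\in\mathcal{N}}\xi_i(\pi)=1$ for all $\pi\in\mathbb{P}$, and matrices $A_i\in\mathbb{R}^{n_x\times n_x}$, $i\in\mathcal{N}$, such that $A(\pi)=\sum_{i\in\mathcal{N}}\xi_i(\pi)A_i$ for all $\pi\in\mathbb{P}$. It is strictly polytopic if, in addition, every unit vector $\boldsymbol{e}_i\in\mathbb{R}^N$, $i\in\mathcal{N}$, belongs to $\xi(\mathbb{P})$, where $\xi=(\xi_1,\dots,\xi_N)$.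 Poly-QS: the polytopic system is poly-quadratically stable (poly-QS) if it admits a poly-quadratic Lyapunov function (poly-QLF), i.e., a function $V\colon\mathbb{P}\times\mathbb{R}^{n_x}\to\mathbb{R}_{\geqslant 0}$ of the form $V(\pi,x)=x^\top P(\pi)x$ with $P(\pi)=\sum_{i\in\mathcal{N}}\xi_i(\pi)\bar{P}_i$, $\bar{P}_i\in\mathbb{S}^{n_x}$ (where $\xi_i\colon\mathbb{P}\to\mathbb{R}_{\geqslant 0}$, $i\in\mathcal{N}$, are the same continuous functions that appear in the polytopic representation $A(\pi)=\sum_{i\in\mathcal{N}}\xi_i(\pi)A_i$ of the system), such that for some $a_1,a_2,a_3>0$: $a_1\|x\|^2\leqslant V(\pi,x)\leqslant a_2\|x\|^2$ and $V(\pi_+,A(\pi)x)\leqslant V(\pi,x)-a_3\|x\|^2$ for all $\pi_+,\pi\in\mathbb{P}$ and $x\in\mathbb{R}^{n_x}$. *)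

theory Defs
  imports "HOL-Analysis.Analysis"
begin

text \<open>
  The state space is \<^typ>\<open>real^'n\<close>, parameters live in a set \<open>PP :: (real^'p) set\<close>, and the
  vertex indices \<open>1, \<dots>, N\<close> are the elements of a finite type \<open>'k\<close>.  The system
  \<open>x (Suc t) = A (p t) *v x t\<close> with arbitrary parameter sequences in \<open>PP\<close> is given by the pair
  \<open>PP\<close>, \<open>A\<close>; values of \<open>A\<close> and of the weight functions outside \<open>PP\<close> are never used.
\<close>

definition symmetric_matrix :: "real^'n^'n \<Rightarrow> bool" where
  "symmetric_matrix M \<longleftrightarrow> transpose M = M"

definition pos_def_matrix :: "real^'n^'n \<Rightarrow> bool" where
  "pos_def_matrix M \<longleftrightarrow> symmetric_matrix M \<and> (\<forall>x. x \<noteq> 0 \<longrightarrow> 0 < x \<bullet> (M *v x))"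

text \<open>
  \<open>block_matrix A B C D\<close> is the 2-by-2 block matrix with rows \<open>A B\<close> and \<open>C D\<close>; its index type is
  the disjoint sum of the index types of the diagonal blocks.
\<close>

definition block_matrix ::
  "real^'m^'m \<Rightarrow> real^'n^'m \<Rightarrow> real^'m^'n \<Rightarrow> real^'n^'n \<Rightarrow> real^('m + 'n)^('m + 'n)" where
  "block_matrix A B C D =
    (\<chi> r c. case r of
       Inl i \<Rightarrow> (case c of Inl j \<Rightarrow> A $ i $ j | Inr j \<Rightarrow> B $ i $ j)
     | Inr i \<Rightarrow> (case c of Inl j \<Rightarrow> C $ i $ j | Inr j \<Rightarrow> D $ i $ j))"

text \<open>The upper right block, usually written as a star, is determined by symmetry.\<close>

definition star_block_matrix ::
  "real^'m^'m \<Rightarrow> real^'m^'n \<Rightarrow> real^'n^'n \<Rightarrow> real^('m + 'n)^('m + 'n)" where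
  "star_block_matrix A C D = block_matrix A (transpose C) C D"

definition weighted_matrix ::
  "(real^'p \<Rightarrow> real^'k) \<Rightarrow> ('k \<Rightarrow> real^'n^'n) \<Rightarrow> real^'p \<Rightarrow> real^'n^'n" where
  "weighted_matrix \<xi> M \<pi> = (\<Sum>i\<in>UNIV. (\<xi> \<pi> $ i) *\<^sub>R M i)"

definition polytopic_with ::
  "(real^'p) set \<Rightarrow> (real^'p \<Rightarrow> real^'n^'n) \<Rightarrow> (real^'p \<Rightarrow> real^'k) \<Rightarrow> ('k \<Rightarrow> real^'n^'n) \<Rightarrow> bool" where
  "polytopic_with PP A \<xi> Av \<longleftrightarrow>
     (\<forall>i. continuous_on PP (\<lambda>\<pi>. \<xi> \<pi> $ i)) \<and>
     (\<forall>\<pi>\<in>PP. \<forall>i. 0 \<le> \<xi> \<pi> $ i) \<and>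
     (\<forall>\<pi>\<in>PP. (\<Sum>i\<in>UNIV. \<xi> \<pi> $ i) = 1) \<and>
     (\<forall>\<pi>\<in>PP. A \<pi> = weighted_matrix \<xi> Av \<pi>)"

definition strictly_polytopic_with ::
  "(real^'p) set \<Rightarrow> (real^'p \<Rightarrow> real^'n^'n) \<Rightarrow> (real^'p \<Rightarrow> real^'k) \<Rightarrow> ('k \<Rightarrow> real^'n^'n) \<Rightarrow> bool" where
  "strictly_polytopic_with PP A \<xi> Av \<longleftrightarrow>
     polytopic_with PP A \<xi> Av \<and> (\<forall>i. axis i 1 \<in> \<xi> ` PP)"

definition poly_form ::
  "(real^'p \<Rightarrow> real^'k) \<Rightarrow> ('k \<Rightarrow> real^'n^'n) \<Rightarrow> real^'p \<Rightarrow> real^'n \<Rightarrow> real" where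
  "poly_form \<xi> Pbar \<pi> x = x \<bullet> (weighted_matrix \<xi> Pbar \<pi> *v x)"

definition poly_QLF ::
  "(real^'p) set \<Rightarrow> (real^'p \<Rightarrow> real^'n^'n) \<Rightarrow> (real^'p \<Rightarrow> real^'k) \<Rightarrow>
   (real^'p \<Rightarrow> real^'n \<Rightarrow> real) \<Rightarrow> bool" where
  "poly_QLF PP A \<xi> V \<longleftrightarrow>
     (\<forall>\<pi>\<in>PP. \<forall>x. 0 \<le> V \<pi> x) \<and>
     (\<exists>Pbar. (\<forall>i. symmetric_matrix (Pbar i)) \<and> (\<forall>\<pi>\<in>PP. \<forall>x. V \<pi> x = poly_form \<xi> Pbar \<pi> x)) \<and>
     (\<exists>a1>0. \<exists>a2>0. \<exists>a3>0.
        (\<forall>\<pi>\<in>PP. \<forall>x. a1 * (norm x)\<^sup>2 \<le> V \<pi> x \<and> V \<pi> x \<le> a2 * (norm x)\<^sup>2) \<and>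
        (\<forall>\<pi>'\<in>PP. \<forall>\<pi>\<in>PP. \<forall>x. V \<pi>' (A \<pi> *v x) \<le> V \<pi> x - a3 * (norm x)\<^sup>2))"

definition poly_QS ::
  "(real^'p) set \<Rightarrow> (real^'p \<Rightarrow> real^'n^'n) \<Rightarrow> (real^'p \<Rightarrow> real^'k) \<Rightarrow> bool" where
  "poly_QS PP A \<xi> \<longleftrightarrow> (\<exists>V. poly_QLF PP A \<xi> V)"

definition poly_QS_via ::
  "(real^'p) set \<Rightarrow> (real^'p \<Rightarrow> real^'n^'n) \<Rightarrow> (real^'p \<Rightarrow> real^'k) \<Rightarrow> ('k \<Rightarrow> real^'n^'n) \<Rightarrow> bool" where
  "poly_QS_via PP A \<xi> Pbar \<longleftrightarrow>
     (\<forall>i. symmetric_matrix (Pbar i)) \<and> poly_QS PP A \<xi> \<and> poly_QLF PP A \<xi> (poly_form \<xi> Pbar)"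

text \<open>
  Since \<^const>\<open>matrix_inv\<close> is unspecified on singular matrices, the existence of the inverses is
  demanded explicitly.
\<close>

definition sym_with_inverses :: "('k \<Rightarrow> real^'n^'n) \<Rightarrow> ('k \<Rightarrow> real^'n^'n) \<Rightarrow> bool" where
  "sym_with_inverses Pbar Sbar \<longleftrightarrow>
     (\<forall>i. symmetric_matrix (Pbar i) \<and> invertible (Pbar i) \<and> Sbar i = matrix_inv (Pbar i))"

definition slack_LMI_inv ::
  "('k \<Rightarrow> real^'n^'n) \<Rightarrow> ('k \<Rightarrow> real^'n^'n) \<Rightarrow> ('k \<Rightarrow> real^'n^'n) \<Rightarrow> ('k \<Rightarrow> real^'n^'n) \<Rightarrow> bool" where
  "slack_LMI_inv Av Pbar Sbar X \<longleftrightarrow>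
     sym_with_inverses Pbar Sbar \<and>
     (\<forall>i j. pos_def_matrix
        (star_block_matrix (X i + transpose (X i) - Sbar i) (Av i ** X i) (Sbar j)))"

definition slack_LMI ::
  "('k \<Rightarrow> real^'n^'n) \<Rightarrow> ('k \<Rightarrow> real^'n^'n) \<Rightarrow> ('k \<Rightarrow> real^'n^'n) \<Rightarrow> bool" where
  "slack_LMI Av Pbar X \<longleftrightarrow>
     (\<forall>i. symmetric_matrix (Pbar i)) \<and>
     (\<forall>i j. pos_def_matrix
        (star_block_matrix (X i + transpose (X i) - Pbar j)
           (transpose (Av i) ** transpose (X i)) (Pbar i)))"

definition LMI_inv ::
  "('k \<Rightarrow> real^'n^'n) \<Rightarrow> ('k \<Rightarrow> real^'n^'n) \<Rightarrow> ('k \<Rightarrow> real^'n^'n) \<Rightarrow> bool" where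
  "LMI_inv Av Pbar Sbar \<longleftrightarrow>
     sym_with_inverses Pbar Sbar \<and>
     (\<forall>i j. pos_def_matrix (star_block_matrix (Sbar i) (Av i ** Sbar i) (Sbar j)))"

end

theory Submission
  imports Defs
begin

text \<open>
  All matrix inequalities are compared with one condition on the vertices (\<open>vertex_decrease\<close>): every
  \<open>Pbar i\<close> is positive definite and \<open>Pbar i - (Av i)\<^sup>T Pbar j Av i\<close> is positive definite for all
  \<open>i\<close>, \<open>j\<close>.  The passage between a matrix and its inverse is always Young's inequality
  \<open>2 (x \<bullet> y) \<le> x \<bullet> M x + y \<bullet> M\<^sup>-\<^sup>1 y\<close>, so no Schur complements are needed.  The condition extends
  from the vertices to the polytope by convexity of \<open>x \<mapsto> x \<bullet> M x\<close>, and under strict polytopicity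
  it is read off at the parameters with \<open>\<xi> \<pi> = axis i 1\<close>.  The second slack inequality follows
  with \<open>X i = (Av i (Pbar i)\<^sup>-\<^sup>1 (Av i)\<^sup>T + \<epsilon> I)\<^sup>-\<^sup>1\<close> for small \<open>\<epsilon> > 0\<close>.
\<close>

section \<open>Positive definite matrices\<close>

lemma inner_vector_matrix:
  fixes M :: "real^'m^'n"
  shows "x \<bullet> (y v* M) = (M *v x) \<bullet> y"
  by (metis dot_lmul_matrix inner_commute)

lemma symmetric_matrix_inner:
  "symmetric_matrix M \<Longrightarrow> x \<bullet> (M *v y) = (M *v x) \<bullet> y"
  by (metis inner_vector_matrix symmetric_matrix_def transpose_matrix_vector)

lemma matrix_vector_minus_right: "M *v (- x) = - (M *v x)" for M :: "real^'m^'n"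
  using matrix_vector_mult_diff_distrib[of M 0 x] by simp

lemma pos_def_matrixD: "pos_def_matrix M \<Longrightarrow> x \<noteq> 0 \<Longrightarrow> 0 < x \<bullet> (M *v x)"
  by (simp add: pos_def_matrix_def)

lemma pos_def_matrix_nonneg: "pos_def_matrix M \<Longrightarrow> 0 \<le> x \<bullet> (M *v x)"
  by (cases "x = 0") (auto dest: pos_def_matrixD simp: less_imp_le)

lemma pos_def_imp_symmetric: "pos_def_matrix M \<Longrightarrow> symmetric_matrix M"
  by (simp add: pos_def_matrix_def)

section \<open>Invertibility and inverses of positive definite matrices\<close>

lemma invertible_if_kernel_trivial:
  fixes M :: "real^'n^'n"
  assumes "\<And>x. M *v x = 0 \<Longrightarrow> x = 0"
  shows "invertible M"
  using assms matrix_left_invertible_ker invertible_left_inverse by blast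

lemma pos_def_imp_invertible: "pos_def_matrix M \<Longrightarrow> invertible M"
  by (rule invertible_if_kernel_trivial) (metis inner_zero_right less_irrefl pos_def_matrixD)

lemma matrix_inv_left_right:
  fixes M :: "real^'n^'n"
  assumes "invertible M"
  shows "matrix_inv M ** M = mat 1" "M ** matrix_inv M = mat 1"
  using someI_ex[OF assms[unfolded invertible_def]] by (simp_all add: matrix_inv_def)

lemma matrix_inv_unique:
  fixes M N :: "real^'n^'n"
  assumes "M ** N = mat 1" "N ** M = mat 1"
  shows "matrix_inv M = N"
proof -
  have "invertible M" using assms by (auto simp: invertible_def)
  then have "matrix_inv M = matrix_inv M ** (M ** N)" by (simp add: assms)
  also have "\<dots> = N" by (simp add: matrix_mul_assoc matrix_inv_left_right \<open>invertible M\<close>)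
  finally show ?thesis .
qed

lemma matrix_inv_vector:
  fixes M :: "real^'n^'n"
  assumes "invertible M"
  shows "M *v (matrix_inv M *v x) = x" "matrix_inv M *v (M *v x) = x"
  using assms by (simp_all add: matrix_vector_mul_assoc matrix_inv_left_right)

lemma symmetric_matrix_inv:
  fixes M :: "real^'n^'n"
  assumes "symmetric_matrix M" "invertible M"
  shows "symmetric_matrix (matrix_inv M)"
proof -
  have "transpose M = M" using assms(1) by (simp add: symmetric_matrix_def)
  then have "M ** transpose (matrix_inv M) = mat 1" "transpose (matrix_inv M) ** M = mat 1"
    using arg_cong[OF matrix_inv_left_right(1)[OF assms(2)], of transpose]
      arg_cong[OF matrix_inv_left_right(2)[OF assms(2)], of transpose]
    by (simp_all add: matrix_transpose_mul)
  then show ?thesis unfolding symmetric_matrix_def by (rule matrix_inv_unique[symmetric])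
qed

lemma pos_def_matrix_inv:
  fixes M :: "real^'n^'n"
  assumes "pos_def_matrix M"
  shows "pos_def_matrix (matrix_inv M)"
proof -
  have inv: "invertible M" and sym: "symmetric_matrix M"
    using assms pos_def_imp_invertible pos_def_imp_symmetric by auto
  have "0 < x \<bullet> (matrix_inv M *v x)" if "x \<noteq> 0" for x
  proof -
    define y where "y = matrix_inv M *v x"
    have x: "x = M *v y" by (simp add: y_def matrix_inv_vector[OF inv])
    then have "y \<noteq> 0" using that by auto
    then have "0 < y \<bullet> (M *v y)" by (rule pos_def_matrixD[OF assms])
    then show ?thesis by (metis x y_def inner_commute)
  qed
  then show ?thesis
    using symmetric_matrix_inv[OF sym inv] by (simp add: pos_def_matrix_def)
qed

lemma matrix_inv_matrix_inv:
  fixes M :: "real^'n^'n"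
  assumes "invertible M"
  shows "matrix_inv (matrix_inv M) = M"
  using assms by (intro matrix_inv_unique) (simp_all add: matrix_inv_left_right)

lemma pos_def_matrix_inv_iff:
  fixes M :: "real^'n^'n"
  assumes "invertible M"
  shows "pos_def_matrix (matrix_inv M) \<longleftrightarrow> pos_def_matrix M"
  using pos_def_matrix_inv matrix_inv_matrix_inv[OF assms] by metis

text \<open>The form of \<open>M\<close> is nonnegative at \<open>x - matrix_inv M *v y\<close>;
  expanding it gives the bound, with equality exactly where this vector vanishes.\<close>

lemma young_inequality_matrix:
  fixes M :: "real^'n^'n"
  assumes "pos_def_matrix M"
  shows "2 * (x \<bullet> y) \<le> x \<bullet> (M *v x) + y \<bullet> (matrix_inv M *v y)"
proof -
  define z where "z = matrix_inv M *v y"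
  have y: "y = M *v z"
    by (simp add: z_def matrix_inv_vector pos_def_imp_invertible[OF assms])
  have "0 \<le> (x - z) \<bullet> (M *v (x - z))" by (rule pos_def_matrix_nonneg[OF assms])
  also have "\<dots> = x \<bullet> (M *v x) - 2 * (x \<bullet> y) + y \<bullet> z"
    using symmetric_matrix_inner[OF pos_def_imp_symmetric[OF assms], of z x]
    by (simp add: y matrix_vector_mult_diff_distrib inner_diff_left inner_diff_right inner_commute)
  finally show ?thesis by (simp add: z_def)
qed

text \<open>By compactness the form attains its minimum on the unit sphere; this minimum serves as
  \<open>c\<close>, and homogeneity of degree two extends the bound to all vectors.\<close>

lemma pos_def_coercive:
  fixes M :: "real^'n^'n"
  assumes "\<And>x. x \<noteq> 0 \<Longrightarrow> 0 < x \<bullet> (M *v x)"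
  obtains c where "c > 0" "\<And>x. c * (norm x)\<^sup>2 \<le> x \<bullet> (M *v x)"
proof -
  have "continuous_on (sphere 0 1) (\<lambda>x. x \<bullet> (M *v x))"
    by (intro continuous_intros linear_continuous_on matrix_vector_mul_bounded_linear)
  moreover have "sphere (0 :: real^'n) 1 \<noteq> {}"
    using norm_axis_1[of undefined] by (metis empty_iff mem_sphere_0)
  ultimately obtain z where z: "z \<in> sphere 0 1"
    and min: "\<And>x. x \<in> sphere 0 1 \<Longrightarrow> z \<bullet> (M *v z) \<le> x \<bullet> (M *v x)"
    using continuous_attains_inf[OF compact_sphere, of 0 1 "\<lambda>x. x \<bullet> (M *v x)"] by blast
  show ?thesis
  proof
    have "z \<noteq> 0" using z by auto
    then show "z \<bullet> (M *v z) > 0" by (rule assms)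
    show "z \<bullet> (M *v z) * (norm x)\<^sup>2 \<le> x \<bullet> (M *v x)" for x
    proof (cases "x = 0")
      case False
      define u where "u = (1 / norm x) *\<^sub>R x"
      have x: "x = norm x *\<^sub>R u" and "u \<in> sphere 0 1" using False by (simp_all add: u_def)
      then have "z \<bullet> (M *v z) * (norm x)\<^sup>2 \<le> u \<bullet> (M *v u) * (norm x)\<^sup>2"
        by (intro mult_right_mono min) simp_all
      also have "\<dots> = (norm x *\<^sub>R u) \<bullet> (M *v (norm x *\<^sub>R u))"
        by (simp add: matrix_vector_mult_scaleR power2_eq_square)
      finally show ?thesis using x by simp
    qed simp
  qed
qed

text \<open>The least of finitely many positive constants is positive. This gives one constant for
  all vertices, or all pairs of vertices, and later supplies \<open>a1\<close>, \<open>a3\<close>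
  and \<open>\<epsilon>\<close>.\<close>

lemma pos_def_family_coercive:
  fixes M :: "'a::finite \<Rightarrow> real^'n^'n"
  assumes "\<And>i x. x \<noteq> 0 \<Longrightarrow> 0 < x \<bullet> (M i *v x)"
  obtains c where "c > 0" "\<And>i x. c * (norm x)\<^sup>2 \<le> x \<bullet> (M i *v x)"
proof -
  have "\<exists>c>0. \<forall>x. c * (norm x)\<^sup>2 \<le> x \<bullet> (M i *v x)" for i
    using pos_def_coercive[of "M i"] assms by metis
  then obtain c where c: "\<And>i. c i > 0" "\<And>i x. c i * (norm x)\<^sup>2 \<le> x \<bullet> (M i *v x)"
    by metis
  show ?thesis
  proof
    show "Min (range c) > 0" using c(1) by simp
    show "Min (range c) * (norm x)\<^sup>2 \<le> x \<bullet> (M i *v x)" for i x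
    proof -
      have "Min (range c) * (norm x)\<^sup>2 \<le> c i * (norm x)\<^sup>2"
        by (intro mult_right_mono Min_le) simp_all
      then show ?thesis using c(2)[of i x] by linarith
    qed
  qed
qed

lemma quadratic_form_family_bounded:
  fixes M :: "'a::finite \<Rightarrow> real^'n^'n"
  obtains c where "c > 0" "\<And>i x. x \<bullet> (M i *v x) \<le> c * (norm x)\<^sup>2"
proof
  let ?c = "\<lambda>i. onorm ((*v) (M i))"
  have nonneg: "0 \<le> ?c i" for i by (simp add: onorm_pos_le matrix_vector_mul_bounded_linear)
  \<comment> \<open>The summand 1 keeps the constant positive even if every matrix is zero.\<close>
  show "(\<Sum>i\<in>UNIV. ?c i) + 1 > 0" using sum_nonneg[of UNIV ?c] nonneg by force
  show "x \<bullet> (M i *v x) \<le> ((\<Sum>i\<in>UNIV. ?c i) + 1) * (norm x)\<^sup>2" for i x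
  proof -
    have "x \<bullet> (M i *v x) \<le> norm x * norm (M i *v x)" by (rule norm_cauchy_schwarz)
    also have "\<dots> \<le> norm x * (?c i * norm x)"
      by (intro mult_left_mono onorm matrix_vector_mul_bounded_linear norm_ge_zero)
    also have "\<dots> = ?c i * (norm x)\<^sup>2" by (simp add: power2_eq_square)
    also have "\<dots> \<le> ((\<Sum>i\<in>UNIV. ?c i) + 1) * (norm x)\<^sup>2"
      using member_le_sum[of i UNIV ?c] nonneg by (intro mult_right_mono) auto
    finally show ?thesis .
  qed
qed

section \<open>Block matrices\<close>

lemma sum_UNIV_Plus:
  fixes f :: "'a::finite + 'b::finite \<Rightarrow> 'c::comm_monoid_add"
  shows "sum f UNIV = (\<Sum>i\<in>UNIV. f (Inl i)) + (\<Sum>j\<in>UNIV. f (Inr j))"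
  by (simp add: UNIV_Plus_UNIV[symmetric] sum.Plus del: UNIV_Plus_UNIV)

lemma star_block_quadratic_form:
  fixes M :: "real^'m^'m" and C :: "real^'m^'n" and D :: "real^'n^'n" and z :: "real^('m + 'n)"
  defines "x \<equiv> (\<chi> i. z $ Inl i)" and "y \<equiv> (\<chi> j. z $ Inr j)"
  shows "z \<bullet> (star_block_matrix M C D *v z) = x \<bullet> (M *v x) + 2 * (y \<bullet> (C *v x)) + y \<bullet> (D *v y)"
proof -
  have top: "(star_block_matrix M C D *v z) $ Inl i = (M *v x) $ i + (transpose C *v y) $ i" for i
    by (simp add: star_block_matrix_def block_matrix_def matrix_vector_mult_def sum_UNIV_Plus x_def y_def)
  have bot: "(star_block_matrix M C D *v z) $ Inr j = (C *v x) $ j + (D *v y) $ j" for j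
    by (simp add: star_block_matrix_def block_matrix_def matrix_vector_mult_def sum_UNIV_Plus x_def y_def)
  have "z \<bullet> (star_block_matrix M C D *v z)
      = x \<bullet> (M *v x + transpose C *v y) + y \<bullet> (C *v x + D *v y)"
    unfolding inner_vec_def sum_UNIV_Plus top bot by (simp add: x_def y_def)
  then show ?thesis
    by (simp add: inner_add_right inner_vector_matrix inner_commute[of "C *v x"])
qed

lemma symmetric_star_block_iff:
  "symmetric_matrix (star_block_matrix M C D) \<longleftrightarrow> symmetric_matrix M \<and> symmetric_matrix D"
  by (auto simp: symmetric_matrix_def star_block_matrix_def block_matrix_def transpose_def
      vec_eq_iff split: sum.split)

text \<open>Splitting a vector into its two components turns a block inequality into a scalar one in
  two free vectors, into which the later proofs insert suitable \<open>x\<close> and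
  \<open>y\<close>.\<close>

lemma pos_def_star_block_iff:
  fixes M :: "real^'m^'m" and C :: "real^'m^'n" and D :: "real^'n^'n"
  shows "pos_def_matrix (star_block_matrix M C D) \<longleftrightarrow>
    symmetric_matrix M \<and> symmetric_matrix D \<and>
    (\<forall>x y. x \<noteq> 0 \<or> y \<noteq> 0 \<longrightarrow> 0 < x \<bullet> (M *v x) + 2 * (y \<bullet> (C *v x)) + y \<bullet> (D *v y))"
    (is "?L \<longleftrightarrow> _ \<and> _ \<and> ?R")
proof -
  have "(\<forall>z. z \<noteq> 0 \<longrightarrow> 0 < z \<bullet> (star_block_matrix M C D *v z)) \<longleftrightarrow> ?R" (is "?Q \<longleftrightarrow> _")
  proof
    assume Q: ?Q
    show ?R
    proof (intro allI impI)
      fix x :: "real^'m" and y :: "real^'n"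
      assume nz: "x \<noteq> 0 \<or> y \<noteq> 0"
      define z :: "real^('m + 'n)" where "z = (\<chi> k. case k of Inl i \<Rightarrow> x $ i | Inr j \<Rightarrow> y $ j)"
      have xy: "x = (\<chi> i. z $ Inl i)" "y = (\<chi> j. z $ Inr j)"
        by (simp_all add: z_def)
      then have "z \<noteq> 0" using nz by (auto simp: vec_eq_iff)
      then have "0 < z \<bullet> (star_block_matrix M C D *v z)" using Q by blast
      then show "0 < x \<bullet> (M *v x) + 2 * (y \<bullet> (C *v x)) + y \<bullet> (D *v y)"
        unfolding star_block_quadratic_form xy[symmetric] .
    qed
  next
    assume R: ?R
    show ?Q
    proof (intro allI impI)
      fix z :: "real^('m + 'n)"
      assume "z \<noteq> 0"
      then obtain k where "z $ k \<noteq> 0" by (auto simp: vec_eq_iff)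
      then have "(\<chi> i. z $ Inl i) \<noteq> (0 :: real^'m) \<or> (\<chi> j. z $ Inr j) \<noteq> (0 :: real^'n)"
        by (cases k) (auto simp: vec_eq_iff)
      then show "0 < z \<bullet> (star_block_matrix M C D *v z)"
        unfolding star_block_quadratic_form using R by blast
    qed
  qed
  then show ?thesis by (auto simp: pos_def_matrix_def symmetric_star_block_iff)
qed

section \<open>The decrease condition on the vertices\<close>

text \<open>The decrease is strict only pointwise; uniform margins are recovered by compactness
  where they are needed.\<close>

definition vertex_decrease :: "('k \<Rightarrow> real^'n^'n) \<Rightarrow> ('k \<Rightarrow> real^'n^'n) \<Rightarrow> bool" where
  "vertex_decrease Av P \<longleftrightarrow>
     (\<forall>i. pos_def_matrix (P i)) \<and>
     (\<forall>i j x. x \<noteq> 0 \<longrightarrow> (Av i *v x) \<bullet> (P j *v (Av i *v x)) < x \<bullet> (P i *v x))"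

lemma slack_LMI_invD:
  assumes "slack_LMI_inv Av P S X"
  shows "invertible (P i)" "S i = matrix_inv (P i)"
    "x \<noteq> 0 \<or> y \<noteq> 0 \<Longrightarrow>
      0 < 2 * (x \<bullet> (X i *v x)) - x \<bullet> (S i *v x) + 2 * (y \<bullet> (Av i *v (X i *v x))) + y \<bullet> (S j *v y)"
  using assms
  by (auto simp: slack_LMI_inv_def sym_with_inverses_def pos_def_star_block_iff
      matrix_vector_mult_diff_rdistrib matrix_vector_mult_add_rdistrib inner_diff_right
      inner_add_right inner_vector_matrix inner_commute matrix_vector_mul_assoc)

lemma slack_LMID:
  assumes "slack_LMI Av P X"
  shows "symmetric_matrix (P i)"
    "x \<noteq> 0 \<or> y \<noteq> 0 \<Longrightarrow>
      0 < 2 * (x \<bullet> (X i *v x)) - x \<bullet> (P j *v x) + 2 * ((Av i *v y) \<bullet> (x v* X i)) + y \<bullet> (P i *v y)"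
proof -
  show "symmetric_matrix (P i)" using assms by (simp add: slack_LMI_def)
  assume "x \<noteq> 0 \<or> y \<noteq> 0"
  then have "0 < x \<bullet> ((X i + transpose (X i) - P j) *v x) +
      2 * (y \<bullet> ((transpose (Av i) ** transpose (X i)) *v x)) + y \<bullet> (P i *v y)"
    using assms by (auto simp: slack_LMI_def pos_def_star_block_iff)
  then show "0 < 2 * (x \<bullet> (X i *v x)) - x \<bullet> (P j *v x) + 2 * ((Av i *v y) \<bullet> (x v* X i)) + y \<bullet> (P i *v y)"
    by (simp add: matrix_vector_mult_diff_rdistrib matrix_vector_mult_add_rdistrib inner_diff_right
        inner_add_right inner_vector_matrix inner_commute[of "X i *v x"] flip: matrix_vector_mul_assoc)
qed

lemma slack_LMI_inv_pos_def:
  assumes "slack_LMI_inv Av P S X"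
  shows "pos_def_matrix (S i)" "pos_def_matrix (P i)"
proof -
  have "symmetric_matrix (S i)"
    using assms by (auto simp: slack_LMI_inv_def pos_def_star_block_iff)
  moreover have "0 < y \<bullet> (S i *v y)" if "y \<noteq> 0" for y
    using slack_LMI_invD(3)[OF assms, of 0 y i i] that by simp
  ultimately show "pos_def_matrix (S i)" by (simp add: pos_def_matrix_def)
  then show "pos_def_matrix (P i)"
    using slack_LMI_invD(1,2)[OF assms] pos_def_matrix_inv_iff by metis
qed

text \<open>At a kernel vector \<open>x\<close> of \<open>X i\<close> and \<open>y = 0\<close>, the
  block form reduces to \<open>- (x \<bullet> (S i *v x))\<close>, which cannot be positive.\<close>

lemma slack_LMI_inv_invertible:
  assumes "slack_LMI_inv Av P S X"
  shows "invertible (X i)"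
proof (rule invertible_if_kernel_trivial, rule ccontr)
  fix x assume "X i *v x = 0" "x \<noteq> 0"
  then show False
    using slack_LMI_invD(3)[OF assms, of x 0 i i]
      pos_def_matrix_nonneg[OF slack_LMI_inv_pos_def(1)[OF assms], of x i] by simp
qed

lemma slack_LMI_pos_def:
  assumes "slack_LMI Av P X"
  shows "pos_def_matrix (P i)"
proof -
  have "0 < y \<bullet> (P i *v y)" if "y \<noteq> 0" for y
    using slack_LMID(2)[OF assms, of 0 y i i] that by simp
  then show ?thesis using slack_LMID(1)[OF assms] by (simp add: pos_def_matrix_def)
qed

lemma slack_LMI_invertible:
  assumes "slack_LMI Av P X"
  shows "invertible (X i)"
proof (rule invertible_if_kernel_trivial, rule ccontr)
  fix x assume "X i *v x = 0" "x \<noteq> 0"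
  then show False
    using slack_LMID(2)[OF assms, of x 0 i i]
      pos_def_matrix_nonneg[OF slack_LMI_pos_def[OF assms], of x i] by simp
qed

text \<open>With slack \<open>X i = S i\<close>, symmetry collapses the upper left block to
  \<open>S i\<close>.\<close>

lemma LMI_inv_imp_slack_LMI_inv:
  assumes "LMI_inv Av P S"
  shows "slack_LMI_inv Av P S S"
proof -
  have "symmetric_matrix (S i)" for i
    using assms by (auto simp: LMI_inv_def pos_def_star_block_iff)
  then show ?thesis
    using assms by (simp add: LMI_inv_def slack_LMI_inv_def symmetric_matrix_def)
qed

lemma slack_LMI_inv_imp_vertex_decrease:
  assumes "slack_LMI_inv Av P S X"
  shows "vertex_decrease Av P"
proof -
  have "(Av i *v u) \<bullet> (P j *v (Av i *v u)) < u \<bullet> (P i *v u)" if "u \<noteq> 0" for i j u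
  proof -
    note inv = slack_LMI_invD(1)[OF assms] and S = slack_LMI_invD(2)[OF assms]
    define x where "x = matrix_inv (X i) *v u"
    define w where "w = Av i *v u"
    have u: "X i *v x = u"
      by (simp add: x_def matrix_inv_vector slack_LMI_inv_invertible[OF assms])
    then have "x \<noteq> 0" using that by auto
    \<comment> \<open>The vector \<open>y = - (P j *v w)\<close> minimises the block form over
      \<open>y\<close>; the terms in \<open>y\<close> then contribute
      \<open>- (w \<bullet> (P j *v w))\<close>.\<close>
    then have "0 < 2 * (x \<bullet> u) - x \<bullet> (S i *v x) + 2 * (- (P j *v w) \<bullet> w)
        + - (P j *v w) \<bullet> (S j *v - (P j *v w))"
      using slack_LMI_invD(3)[OF assms, of x "- (P j *v w)" i j] by (simp add: u w_def)
    also have "\<dots> = 2 * (x \<bullet> u) - x \<bullet> (S i *v x) - w \<bullet> (P j *v w)"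
      by (simp add: matrix_vector_minus_right S matrix_inv_vector inv inner_commute)
    \<comment> \<open>Young's inequality for \<open>S i\<close>, whose inverse is
      \<open>P i\<close>, removes the slack variable.\<close>
    also have "\<dots> \<le> u \<bullet> (P i *v u) - w \<bullet> (P j *v w)"
      using young_inequality_matrix[OF slack_LMI_inv_pos_def(1)[OF assms], of x u i]
      by (simp add: S matrix_inv_matrix_inv inv)
    finally show ?thesis by (simp add: w_def)
  qed
  then show ?thesis by (simp add: vertex_decrease_def slack_LMI_inv_pos_def[OF assms])
qed

text \<open>For \<open>u = S i *v x\<close> the first term equals
  \<open>u \<bullet> (P i *v u)\<close>, which strictly dominates the form of \<open>P j\<close> at
  \<open>Av i *v u\<close>; Young's inequality for \<open>P j\<close> then absorbs the cross
  term.\<close>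

lemma vertex_decrease_imp_LMI_inv:
  assumes "vertex_decrease Av P"
  shows "LMI_inv Av P (\<lambda>i. matrix_inv (P i))"
proof -
  define S where "S = (\<lambda>i. matrix_inv (P i))"
  have P: "pos_def_matrix (P i)" for i using assms by (simp add: vertex_decrease_def)
  have inv: "invertible (P i)" and S: "pos_def_matrix (S i)" for i
    by (simp_all add: P pos_def_imp_invertible pos_def_matrix_inv S_def)
  have "0 < x \<bullet> (S i *v x) + 2 * (y \<bullet> (Av i *v (S i *v x))) + y \<bullet> (S j *v y)"
    if nz: "x \<noteq> 0 \<or> y \<noteq> 0" for i j x y
  proof (cases "x = 0")
    case True
    then show ?thesis using nz pos_def_matrixD[OF S, of y j] by simp
  next
    case False
    define u where "u = S i *v x"
    have x: "x = P i *v u" by (simp add: u_def S_def matrix_inv_vector inv)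
    then have "u \<noteq> 0" using False by auto
    then have "(Av i *v u) \<bullet> (P j *v (Av i *v u)) < u \<bullet> (P i *v u)"
      using assms by (simp add: vertex_decrease_def)
    moreover have "2 * (- (Av i *v u) \<bullet> y) \<le> (Av i *v u) \<bullet> (P j *v (Av i *v u)) + y \<bullet> (S j *v y)"
      using young_inequality_matrix[OF P[of j], of "- (Av i *v u)" y]
      by (simp add: matrix_vector_minus_right S_def)
    moreover have "u \<bullet> (P i *v u) = x \<bullet> u" by (simp add: x inner_commute)
    ultimately show ?thesis
      by (simp add: inner_commute[of y] flip: u_def)
  qed
  then have "pos_def_matrix (star_block_matrix (S i) (Av i ** S i) (S j))" for i j
    using S by (simp add: pos_def_star_block_iff pos_def_imp_symmetric matrix_vector_mul_assoc)
  then show ?thesis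
    by (simp add: LMI_inv_def sym_with_inverses_def inv pos_def_imp_symmetric[OF P] S_def)
qed

text \<open>For \<open>y = u\<close> and \<open>x = - (Av i *v u)\<close> the two terms containing
  \<open>X i\<close> cancel, and what remains is the decrease at \<open>u\<close>.\<close>

lemma slack_LMI_imp_vertex_decrease:
  assumes "slack_LMI Av P X"
  shows "vertex_decrease Av P"
proof -
  have "(Av i *v u) \<bullet> (P j *v (Av i *v u)) < u \<bullet> (P i *v u)" if "u \<noteq> 0" for i j u
    using slack_LMID(2)[OF assms, of "- (Av i *v u)" u i j] that
    by (simp add: matrix_vector_minus_right dot_lmul_matrix inner_vector_matrix inner_commute)
  then show ?thesis by (simp add: vertex_decrease_def slack_LMI_pos_def[OF assms])
qed

section \<open>The second slack inequality, by duality\<close>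

text \<open>The decrease condition passes to the dual system with matrices \<open>(Av i)\<^sup>T\<close> and \<open>(P i)\<^sup>-\<^sup>1\<close>.\<close>

lemma vertex_decrease_dual:
  assumes "vertex_decrease Av P" "y \<noteq> 0"
  shows "(y v* Av i) \<bullet> (matrix_inv (P i) *v (y v* Av i)) < y \<bullet> (matrix_inv (P j) *v y)"
proof -
  have P: "pos_def_matrix (P i)" for i using assms by (simp add: vertex_decrease_def)
  define u where "u = matrix_inv (P i) *v (y v* Av i)"
  define w where "w = Av i *v u"
  have Pu: "y v* Av i = P i *v u"
    by (simp add: u_def matrix_inv_vector pos_def_imp_invertible P)
  have yw: "(y v* Av i) \<bullet> u = w \<bullet> y" by (simp add: w_def dot_lmul_matrix inner_commute[of "Av i *v u"])
  show ?thesis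
  proof (cases "u = 0")
    case True
    then show ?thesis
      using pos_def_matrixD[OF pos_def_matrix_inv[OF P] assms(2)] by (simp add: u_def)
  next
    case False
    then have "w \<bullet> (P j *v w) < u \<bullet> (P i *v u)"
      using assms by (simp add: vertex_decrease_def w_def)
    also have "\<dots> = w \<bullet> y" using yw by (simp add: Pu inner_commute)
    \<comment> \<open>Young's inequality bounds \<open>2 * (w \<bullet> y)\<close> by the forms of
      \<open>P j\<close> at \<open>w\<close> and of its inverse at \<open>y\<close>. The former is
      below \<open>w \<bullet> y\<close>, so one copy cancels; the other is the left-hand side of
      the claim.\<close>
    finally show ?thesis
      using young_inequality_matrix[OF P[of j], of w y] yw by (simp add: u_def)
  qed
qed

text \<open>One \<open>X\<close> has to serve all \<open>j\<close>. Duality places \<open>R\<close>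
  strictly below every \<open>S j\<close>, so some \<open>T = R + \<epsilon> I\<close> still lies
  below them all. Inversion reverses the order, so \<open>X = matrix_inv T\<close> dominates every
  \<open>P j\<close>, and the upper left block dominates \<open>X\<close>. The strict gap between
  \<open>T\<close> and \<open>R\<close> makes the remaining block form positive.\<close>

lemma vertex_decrease_imp_slack_matrix:
  fixes Av P :: "'k::finite \<Rightarrow> real^'n^'n"
  assumes "vertex_decrease Av P"
  shows "\<exists>X. \<forall>j. pos_def_matrix
    (star_block_matrix (X + transpose X - P j) (transpose (Av i) ** transpose X) (P i))"
proof -
  define S where "S = (\<lambda>i. matrix_inv (P i))"
  have P: "pos_def_matrix (P i)" for i using assms by (simp add: vertex_decrease_def)
  have S: "pos_def_matrix (S i)" for i by (simp add: S_def pos_def_matrix_inv P)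
  define R where "R = Av i ** S i ** transpose (Av i)"
  have R: "x \<bullet> (R *v y) = (x v* Av i) \<bullet> (S i *v (y v* Av i))" for x y
    by (simp add: R_def dot_lmul_matrix flip: matrix_vector_mul_assoc)
  have "0 < y \<bullet> ((S j - R) *v y)" if "y \<noteq> 0" for j y
    using vertex_decrease_dual[OF assms that, of i j]
    by (simp add: matrix_vector_mult_diff_rdistrib inner_diff_right R S_def)
  then obtain \<epsilon> where \<epsilon>: "\<epsilon> > 0" and "\<And>j y. \<epsilon> * (norm y)\<^sup>2 \<le> y \<bullet> ((S j - R) *v y)"
    using pos_def_family_coercive[of "\<lambda>j. S j - R"] by metis
  then have gap: "y \<bullet> (R *v y) + \<epsilon> * (norm y)\<^sup>2 \<le> y \<bullet> (S j *v y)" for j y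
    by (simp add: matrix_vector_mult_diff_rdistrib inner_diff_right algebra_simps)
  \<comment> \<open>Since \<open>R\<close> may be singular, the multiple of the identity also
    ensures that \<open>T\<close> is invertible.\<close>
  define T where "T = R + \<epsilon> *\<^sub>R mat 1"
  have Tv: "T *v v = R *v v + \<epsilon> *\<^sub>R v" for v
    by (simp add: T_def matrix_vector_mult_add_rdistrib flip: scaleR_matrix_vector_assoc)
  have T: "x \<bullet> (T *v x) = x \<bullet> (R *v x) + \<epsilon> * (norm x)\<^sup>2" for x
    by (simp add: Tv inner_add_right power2_norm_eq_inner)
  have posT: "pos_def_matrix T"
  proof -
    have "transpose R = R"
      using pos_def_imp_symmetric[OF S, of i]
      by (simp add: R_def matrix_transpose_mul matrix_mul_assoc symmetric_matrix_def)
    then have "symmetric_matrix T"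
      by (simp add: symmetric_matrix_def T_def transpose_def mat_def vec_eq_iff)
    moreover have "0 < x \<bullet> (T *v x)" if "x \<noteq> 0" for x
      using that \<epsilon> pos_def_matrix_nonneg[OF S] by (simp add: T R add_nonneg_pos)
    ultimately show ?thesis by (simp add: pos_def_matrix_def)
  qed
  define X where "X = matrix_inv T"
  have symX: "transpose X = X"
    using pos_def_imp_symmetric[OF pos_def_matrix_inv[OF posT]]
    by (simp add: X_def symmetric_matrix_def)
  have "0 < x \<bullet> ((X + transpose X - P j) *v x) +
      2 * (y \<bullet> ((transpose (Av i) ** transpose X) *v x)) + y \<bullet> (P i *v y)"
    if nz: "x \<noteq> 0 \<or> y \<noteq> 0" for j x y
  proof (cases "x = 0")
    case True
    then show ?thesis using nz pos_def_matrixD[OF P, of y i] by simp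
  next
    case False
    define v where "v = X *v x"
    have x: "x = T *v v"
      by (simp add: v_def X_def matrix_inv_vector pos_def_imp_invertible[OF posT])
    then have "v \<noteq> 0" using False by auto
    \<comment> \<open>The form of \<open>R\<close> at \<open>v\<close> is that of \<open>S i\<close>
      at \<open>v v* Av i\<close>, hence exactly the price Young's inequality for \<open>P i\<close>
      charges for the cross term.\<close>
    have cross: "- 2 * (y \<bullet> (v v* Av i)) \<le> y \<bullet> (P i *v y) + v \<bullet> (R *v v)"
      using young_inequality_matrix[OF P[of i], of y "- (v v* Av i)"]
      by (simp add: matrix_vector_minus_right R S_def)
    \<comment> \<open>This vector reverses the order under inversion: \<open>S j\<close> maps
      \<open>q\<close> to \<open>x\<close>, so the gap bounds the form of \<open>T\<close> at
      \<open>q\<close> by \<open>q \<bullet> x\<close>, and Young's inequality for \<open>T\<close>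
      leaves \<open>q \<bullet> x \<le> v \<bullet> x\<close>.\<close>
    define q where "q = P j *v x"
    have Sq: "S j *v q = x"
      by (simp add: q_def S_def matrix_inv_vector pos_def_imp_invertible P)
    have "2 * (q \<bullet> x) \<le> q \<bullet> (T *v q) + v \<bullet> x"
      using young_inequality_matrix[OF posT, of q x] by (simp add: v_def X_def inner_commute)
    also have "q \<bullet> (T *v q) \<le> q \<bullet> x" using gap[of q j] by (simp add: T Sq)
    finally have upper: "x \<bullet> (P j *v x) \<le> x \<bullet> v" by (simp add: q_def inner_commute)
    \<comment> \<open>After \<open>upper\<close> and \<open>cross\<close>, the block form is at
      least \<open>x \<bullet> v - v \<bullet> (R *v v)\<close>, which is the positive margin
      computed here.\<close>
    have "x \<bullet> v = v \<bullet> (R *v v) + \<epsilon> * (norm v)\<^sup>2"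
      by (metis T inner_commute x)
    moreover have "0 < \<epsilon> * (norm v)\<^sup>2" using \<epsilon> \<open>v \<noteq> 0\<close> by simp
    moreover have "x \<bullet> ((X + transpose X - P j) *v x) = 2 * (x \<bullet> v) - x \<bullet> (P j *v x)"
      by (simp add: matrix_vector_mult_diff_rdistrib matrix_vector_mult_add_rdistrib
          inner_diff_right inner_add_right inner_vector_matrix inner_commute[of "X *v x"] v_def)
    moreover have "(transpose (Av i) ** transpose X) *v x = v v* Av i"
      by (simp add: symX v_def flip: matrix_vector_mul_assoc)
    ultimately show ?thesis using cross upper by simp
  qed
  moreover have "symmetric_matrix (X + transpose X - P j)" for j
    using pos_def_imp_symmetric[OF P, of j] symX
    by (simp add: symmetric_matrix_def transpose_def vec_eq_iff)
  ultimately show ?thesis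
    using pos_def_imp_symmetric[OF P] unfolding pos_def_star_block_iff by blast
qed

lemma vertex_decrease_imp_slack_LMI:
  fixes Av P :: "'k::finite \<Rightarrow> real^'n^'n"
  assumes "vertex_decrease Av P"
  shows "\<exists>X. slack_LMI Av P X"
proof -
  obtain X where "\<And>i j. pos_def_matrix
      (star_block_matrix (X i + transpose (X i) - P j) (transpose (Av i) ** transpose (X i)) (P i))"
    using vertex_decrease_imp_slack_matrix[OF assms] by metis
  moreover have "symmetric_matrix (P i)" for i
    using assms by (simp add: vertex_decrease_def pos_def_matrix_def)
  ultimately show ?thesis by (auto simp: slack_LMI_def)
qed

section \<open>Poly-quadratic Lyapunov functions\<close>

lemma weighted_matrix_vector:
  "weighted_matrix \<xi> M \<pi> *v x = (\<Sum>i\<in>UNIV. (\<xi> \<pi> $ i) *\<^sub>R (M i *v x))"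
proof -
  have "(\<Sum>i\<in>I. (\<xi> \<pi> $ i) *\<^sub>R M i) *v x = (\<Sum>i\<in>I. (\<xi> \<pi> $ i) *\<^sub>R (M i *v x))" if "finite I" for I
    using that
    by induction (simp_all add: matrix_vector_mult_add_rdistrib scaleR_matrix_vector_assoc)
  then show ?thesis by (simp add: weighted_matrix_def)
qed

lemma poly_form_eq: "poly_form \<xi> M \<pi> x = (\<Sum>i\<in>UNIV. \<xi> \<pi> $ i * (x \<bullet> (M i *v x)))"
  by (simp add: poly_form_def weighted_matrix_vector inner_sum_right)

lemma convex_combination_mono:
  fixes f g :: "'a::finite \<Rightarrow> real"
  assumes "\<And>i. 0 \<le> w i" "sum w UNIV = 1"
  shows "(\<And>i. f i \<le> c) \<Longrightarrow> (\<Sum>i\<in>UNIV. w i * f i) \<le> c"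
    and "(\<And>i. c \<le> f i) \<Longrightarrow> c \<le> (\<Sum>i\<in>UNIV. w i * f i)"
proof -
  have c: "(\<Sum>i\<in>UNIV. w i * c) = c" using assms(2) by (simp flip: sum_distrib_right)
  show "(\<Sum>i\<in>UNIV. w i * f i) \<le> c" if "\<And>i. f i \<le> c"
    using sum_mono[of UNIV "\<lambda>i. w i * f i" "\<lambda>i. w i * c"] that assms(1) c
    by (simp add: mult_left_mono)
  show "c \<le> (\<Sum>i\<in>UNIV. w i * f i)" if "\<And>i. c \<le> f i"
    using sum_mono[of UNIV "\<lambda>i. w i * c" "\<lambda>i. w i * f i"] that assms(1) c
    by (simp add: mult_left_mono)
qed

text \<open>Jensen's inequality, from \<open>2 (z \<bullet> M y\<^sub>i) - z \<bullet> M z \<le> y\<^sub>i \<bullet> M y\<^sub>i\<close> with \<open>z\<close> the mean of the \<open>y\<^sub>i\<close>.\<close>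

lemma quadratic_form_convex:
  fixes y :: "'a::finite \<Rightarrow> real^'n"
  assumes M: "pos_def_matrix M" and w: "\<And>i. 0 \<le> w i" "sum w UNIV = 1"
  defines "z \<equiv> \<Sum>i\<in>UNIV. w i *\<^sub>R y i"
  shows "z \<bullet> (M *v z) \<le> (\<Sum>i\<in>UNIV. w i * (y i \<bullet> (M *v y i)))"
proof -
  have "2 * (y i \<bullet> (M *v z)) - z \<bullet> (M *v z) \<le> y i \<bullet> (M *v y i)" for i
    using young_inequality_matrix[OF M, of "y i" "M *v z"]
    by (simp add: matrix_inv_vector pos_def_imp_invertible[OF M] inner_commute)
  then have "(\<Sum>i\<in>UNIV. w i * (2 * (y i \<bullet> (M *v z)) - z \<bullet> (M *v z)))
      \<le> (\<Sum>i\<in>UNIV. w i * (y i \<bullet> (M *v y i)))"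
    using w(1) by (intro sum_mono mult_left_mono)
  moreover have "(\<Sum>i\<in>UNIV. w i * (2 * (y i \<bullet> (M *v z)) - z \<bullet> (M *v z)))
      = 2 * (\<Sum>i\<in>UNIV. w i * (y i \<bullet> (M *v z))) - sum w UNIV * (z \<bullet> (M *v z))"
    by (simp add: right_diff_distrib sum_subtractf sum_distrib_left sum_distrib_right mult.left_commute)
  moreover have "(\<Sum>i\<in>UNIV. w i * (y i \<bullet> (M *v z))) = z \<bullet> (M *v z)"
    by (simp add: z_def inner_sum_left)
  ultimately show ?thesis using w(2) by simp
qed

text \<open>For fixed \<open>x\<close>, the function is a convex combination of the vertex forms, so
  its bounds come from the vertices. For the decrease, the successor parameter is averaged over
  \<open>j\<close> and Jensen's inequality splits \<open>A \<pi> *v x\<close> over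
  \<open>i\<close>.\<close>

lemma vertex_decrease_imp_poly_QS_via:
  fixes A :: "real^'p \<Rightarrow> real^'n^'n" and \<xi> :: "real^'p \<Rightarrow> real^'k"
  assumes poly: "polytopic_with PP A \<xi> Av" and dec: "vertex_decrease Av P"
  shows "poly_QS_via PP A \<xi> P"
proof -
  have P: "pos_def_matrix (P i)" for i using dec by (simp add: vertex_decrease_def)
  have \<xi>: "0 \<le> \<xi> \<pi> $ i" "(\<Sum>i\<in>UNIV. \<xi> \<pi> $ i) = 1" if "\<pi> \<in> PP" for \<pi> i
    using poly that by (auto simp: polytopic_with_def)
  obtain a1 where a1: "a1 > 0" "\<And>i x. a1 * (norm x)\<^sup>2 \<le> x \<bullet> (P i *v x)"
    using pos_def_family_coercive[of P] pos_def_matrixD[OF P] by metis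
  obtain a2 where a2: "a2 > 0" "\<And>i x. x \<bullet> (P i *v x) \<le> a2 * (norm x)\<^sup>2"
    using quadratic_form_family_bounded[of P] by metis
  \<comment> \<open>Indexing by pairs makes this one finite family, so a single \<open>a3\<close>
    works for all \<open>i\<close> and \<open>j\<close>.\<close>
  define D where "D = (\<lambda>(i, j). P i - transpose (Av i) ** P j ** Av i)"
  have D: "x \<bullet> (D (i, j) *v x) = x \<bullet> (P i *v x) - (Av i *v x) \<bullet> (P j *v (Av i *v x))" for i j x
    by (simp add: D_def matrix_vector_mult_diff_rdistrib inner_diff_right inner_vector_matrix
        flip: matrix_vector_mul_assoc)
  have "0 < x \<bullet> (D ij *v x)" if "x \<noteq> 0" for ij x
    using dec that by (cases ij) (simp add: D vertex_decrease_def)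
  then obtain a3 where a3: "a3 > 0" "\<And>ij x. a3 * (norm x)\<^sup>2 \<le> x \<bullet> (D ij *v x)"
    using pos_def_family_coercive[of D] by metis
  have lower: "a1 * (norm x)\<^sup>2 \<le> poly_form \<xi> P \<pi> x" if "\<pi> \<in> PP" for \<pi> x
    unfolding poly_form_eq by (rule convex_combination_mono(2)[OF \<xi>[OF that] a1(2)])
  have upper: "poly_form \<xi> P \<pi> x \<le> a2 * (norm x)\<^sup>2" if "\<pi> \<in> PP" for \<pi> x
    unfolding poly_form_eq by (rule convex_combination_mono(1)[OF \<xi>[OF that] a2(2)])
  have decrease: "poly_form \<xi> P \<pi>' (A \<pi> *v x) \<le> poly_form \<xi> P \<pi> x - a3 * (norm x)\<^sup>2"
    if \<pi>': "\<pi>' \<in> PP" and \<pi>: "\<pi> \<in> PP" for \<pi>' \<pi> x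
    \<comment> \<open>Only the form at the successor parameter is expanded; the right-hand side
      stays a bound independent of \<open>j\<close>.\<close>
    unfolding poly_form_eq[of \<xi> P \<pi>']
  proof (rule convex_combination_mono(1)[OF \<xi>[OF \<pi>']])
    fix j
    have "A \<pi> *v x = (\<Sum>i\<in>UNIV. (\<xi> \<pi> $ i) *\<^sub>R (Av i *v x))"
      using poly \<pi> by (simp add: polytopic_with_def weighted_matrix_vector)
    then have "(A \<pi> *v x) \<bullet> (P j *v (A \<pi> *v x))
        \<le> (\<Sum>i\<in>UNIV. \<xi> \<pi> $ i * ((Av i *v x) \<bullet> (P j *v (Av i *v x))))"
      using quadratic_form_convex[OF P \<xi>[OF \<pi>]] by simp
    also have "\<dots> = poly_form \<xi> P \<pi> x - (\<Sum>i\<in>UNIV. \<xi> \<pi> $ i * (x \<bullet> (D (i, j) *v x)))"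
      by (simp add: poly_form_eq D right_diff_distrib sum_subtractf)
    also have "\<dots> \<le> poly_form \<xi> P \<pi> x - a3 * (norm x)\<^sup>2"
      using convex_combination_mono(2)[OF \<xi>[OF \<pi>], of _ "\<lambda>i. x \<bullet> (D (i, j) *v x)"] a3(2) by simp
    finally show "(A \<pi> *v x) \<bullet> (P j *v (A \<pi> *v x)) \<le> poly_form \<xi> P \<pi> x - a3 * (norm x)\<^sup>2" .
  qed
  have nonneg: "0 \<le> poly_form \<xi> P \<pi> x" if "\<pi> \<in> PP" for \<pi> x
    using order_trans[OF _ lower[OF that]] a1(1) by simp
  have sym: "\<forall>i. symmetric_matrix (P i)" using pos_def_imp_symmetric[OF P] by simp
  have "\<exists>a1>0. \<exists>a2>0. \<exists>a3>0.
      (\<forall>\<pi>\<in>PP. \<forall>x. a1 * (norm x)\<^sup>2 \<le> poly_form \<xi> P \<pi> x \<and> poly_form \<xi> P \<pi> x \<le> a2 * (norm x)\<^sup>2) \<and>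
      (\<forall>\<pi>'\<in>PP. \<forall>\<pi>\<in>PP. \<forall>x. poly_form \<xi> P \<pi>' (A \<pi> *v x) \<le> poly_form \<xi> P \<pi> x - a3 * (norm x)\<^sup>2)"
    by (intro exI[of _ a1] conjI[OF a1(1)] exI[of _ a2] conjI[OF a2(1)] exI[of _ a3] conjI[OF a3(1)])
      (simp add: lower upper decrease)
  then have "poly_QLF PP A \<xi> (poly_form \<xi> P)"
    unfolding poly_QLF_def using sym nonneg by blast
  then show ?thesis
    using sym by (auto simp: poly_QS_via_def poly_QS_def)
qed

lemma weighted_matrix_axis: "\<xi> \<pi> = axis i 1 \<Longrightarrow> weighted_matrix \<xi> M \<pi> = M i"
  by (simp add: weighted_matrix_def axis_def if_distrib[of "\<lambda>c. c *\<^sub>R _"] cong: if_cong)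

lemma poly_QS_via_imp_vertex_decrease:
  fixes A :: "real^'p \<Rightarrow> real^'n^'n" and \<xi> :: "real^'p \<Rightarrow> real^'k"
  assumes strict: "strictly_polytopic_with PP A \<xi> Av" and QS: "poly_QS_via PP A \<xi> P"
  shows "vertex_decrease Av P"
proof -
  \<comment> \<open>At \<open>p i\<close> both \<open>A\<close> and the weighted matrix take their
    \<open>i\<close>-th vertex values. Using \<open>p j\<close> as successor of \<open>p i\<close>
    yields every pair, because the successor parameter is arbitrary.\<close>
  obtain p where p: "\<And>i. p i \<in> PP" "\<And>i. \<xi> (p i) = axis i 1"
    using strict unfolding strictly_polytopic_with_def image_iff by metis
  have A: "A (p i) = Av i" for i
    using strict p by (simp add: strictly_polytopic_with_def polytopic_with_def weighted_matrix_axis)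
  have V: "poly_form \<xi> P (p i) x = x \<bullet> (P i *v x)" for i x
    by (simp add: poly_form_def weighted_matrix_axis p(2))
  obtain a1 a3 where pos: "a1 > 0" "a3 > 0"
    and lower: "\<And>\<pi> x. \<pi> \<in> PP \<Longrightarrow> a1 * (norm x)\<^sup>2 \<le> poly_form \<xi> P \<pi> x"
    and decrease: "\<And>\<pi>' \<pi> x. \<pi>' \<in> PP \<Longrightarrow> \<pi> \<in> PP \<Longrightarrow>
      poly_form \<xi> P \<pi>' (A \<pi> *v x) \<le> poly_form \<xi> P \<pi> x - a3 * (norm x)\<^sup>2"
    using QS unfolding poly_QS_via_def poly_QLF_def by blast
  have "0 < x \<bullet> (P i *v x)" if "x \<noteq> 0" for i x
  proof -
    have "0 < a1 * (norm x)\<^sup>2" using pos that by simp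
    also have "\<dots> \<le> x \<bullet> (P i *v x)" using lower[OF p(1)[of i], of x] by (simp add: V)
    finally show ?thesis .
  qed
  moreover have "(Av i *v x) \<bullet> (P j *v (Av i *v x)) < x \<bullet> (P i *v x)" if "x \<noteq> 0" for i j x
  proof -
    have "0 < a3 * (norm x)\<^sup>2" using pos that by simp
    then show ?thesis using decrease[OF p(1)[of j] p(1)[of i], of x] by (simp add: V A)
  qed
  ultimately show ?thesis
    using QS by (simp add: vertex_decrease_def pos_def_matrix_def poly_QS_via_def)
qed

theorem lemma1:
  fixes PP :: "(real^'p) set"
    and A :: "real^'p \<Rightarrow> real^'n^'n"
    and \<xi> :: "real^'p \<Rightarrow> real^'k"
    and Av :: "'k \<Rightarrow> real^'n^'n"
  assumes "compact PP"
    and "polytopic_with PP A \<xi> Av"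
  shows
    "(\<forall>Pbar. (\<exists>Sbar. LMI_inv Av Pbar Sbar) \<longleftrightarrow> (\<exists>Sbar X. slack_LMI_inv Av Pbar Sbar X)) \<and>
     (\<forall>Pbar. (\<exists>Sbar X. slack_LMI_inv Av Pbar Sbar X) \<longrightarrow> poly_QS_via PP A \<xi> Pbar) \<and>
     (\<forall>Pbar. (\<exists>X. slack_LMI Av Pbar X) \<longrightarrow> poly_QS_via PP A \<xi> Pbar) \<and>
     (\<forall>Pbar Sbar X. slack_LMI_inv Av Pbar Sbar X \<longrightarrow> (\<forall>i. invertible (X i))) \<and>
     (\<forall>Pbar X. slack_LMI Av Pbar X \<longrightarrow> (\<forall>i. invertible (X i))) \<and>
     (strictly_polytopic_with PP A \<xi> Av \<longrightarrow>
        ((\<exists>Pbar. poly_QS_via PP A \<xi> Pbar) \<longleftrightarrow> (\<exists>Pbar Sbar X. slack_LMI_inv Av Pbar Sbar X)) \<and>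
        ((\<exists>Pbar. poly_QS_via PP A \<xi> Pbar) \<longleftrightarrow> (\<exists>Pbar X. slack_LMI Av Pbar X)) \<and>
        ((\<exists>Pbar. poly_QS_via PP A \<xi> Pbar) \<longleftrightarrow> (\<exists>Pbar Sbar. LMI_inv Av Pbar Sbar)))"
proof -
  \<comment> \<open>With the auxiliary matrices quantified away, each family of inequalities is
    equivalent to the same condition on \<open>Pbar\<close>, so every implication keeps
    \<open>Pbar\<close> fixed.\<close>
  have LMI_inv: "(\<exists>Sbar. LMI_inv Av Pbar Sbar) \<longleftrightarrow> vertex_decrease Av Pbar"
    and slack_inv: "(\<exists>Sbar X. slack_LMI_inv Av Pbar Sbar X) \<longleftrightarrow> vertex_decrease Av Pbar"
    and slack: "(\<exists>X. slack_LMI Av Pbar X) \<longleftrightarrow> vertex_decrease Av Pbar" for Pbar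
    using vertex_decrease_imp_LMI_inv LMI_inv_imp_slack_LMI_inv slack_LMI_inv_imp_vertex_decrease
      vertex_decrease_imp_slack_LMI slack_LMI_imp_vertex_decrease by metis+
  have QS: "vertex_decrease Av Pbar \<Longrightarrow> poly_QS_via PP A \<xi> Pbar" for Pbar
    by (rule vertex_decrease_imp_poly_QS_via[OF assms(2)])
  have strict: "poly_QS_via PP A \<xi> Pbar \<longleftrightarrow> vertex_decrease Av Pbar"
    if "strictly_polytopic_with PP A \<xi> Av" for Pbar
    using QS poly_QS_via_imp_vertex_decrease[OF that] by blast
  show ?thesis
    \<comment> \<open>This makes the first claim trivial. The two invertibility claims concern every
      admissible \<open>X\<close> rather than the existence of one, so they are proved
      separately.\<close>
    unfolding LMI_inv slack_inv slack
  proof (intro conjI allI impI)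
    show "invertible (X i)" if "slack_LMI_inv Av Pbar Sbar X" for Pbar Sbar X i
      using that by (rule slack_LMI_inv_invertible)
    show "invertible (X i)" if "slack_LMI Av Pbar X" for Pbar X i
      using that by (rule slack_LMI_invertible)
  qed (simp_all add: QS strict)
qed

end
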